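(* Let $\varphi:\mathbb{R}\to\mathbb{R}$ be a smooth function, let $a\in\mathbb{R}$ be a root of $\varphi$ (i.e. $\varphi(a)=0$), and let $\mathcal{U}$ be a one-sided neighborhood of $a$. Assume that $|\varphi'(x)|$ is strictly increasing in $|x-a|$ for $x\in\mathcal{U}$, i.e. for all $x,y\in\mathcal{U}$ with $|x-a|<|y-a|$ one has $|\varphi'(x)|<|\varphi'(y)|$ (which implies in particular that $a$ is the only root of $\varphi$ on $\mathcal{U}$ and that $\varphi$ is monotone on $\mathcal{U}$). Then for all $x,y\in\mathcal{U}$ with $x\neq a$, $y\neq a$ and $x\neq y$, $$0<\frac{S(x,y)-a}{x-a}<1 .$$ That is, the distance to $a$ strictly decreases when passing from $x$ to $S(x,y)$.
   Context: For $x\neq y$ define the difference quotient $\Delta(x,y)=\frac{\varphi(x)-\varphi(y)}{x-y}$ and the secant step $S(x,y)=x-\frac{\varphi(x)}{\Delta(x,y)}$. The secant method is the recursion $x_{n+1}=S(x_n,x_{n-1})$. A one-sided neighborhood of $a$ is an interval with $a$ as an endpoint lying on one side of $a$, i.e. of the form $[a,a+r)$ or $(a-r,a]$ for some $r>0$. Here "smooth" means sufficiently differentiable (in particular continuously differentiable). *)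

theory Defs
  imports "HOL-Analysis.Analysis"
begin

(* Meant for x \<noteq> y; for x = y the value is 0 by the convention 0 / 0 = 0. *)
definition diff_quot :: "(real \<Rightarrow> real) \<Rightarrow> real \<Rightarrow> real \<Rightarrow> real" where
  "diff_quot \<phi> x y = (\<phi> x - \<phi> y) / (x - y)"

(* Meant for nonzero difference quotients; otherwise division by zero gives x. *)
definition secant_step :: "(real \<Rightarrow> real) \<Rightarrow> real \<Rightarrow> real \<Rightarrow> real" where
  "secant_step \<phi> x y = x - \<phi> x / diff_quot \<phi> x y"

definition one_sided_nbhd :: "real \<Rightarrow> real set \<Rightarrow> bool" where
  "one_sided_nbhd a U \<longleftrightarrow> (\<exists>r>0. U = {a..<a + r} \<or> U = {a - r<..a})"

end

theory Submission
  imports Defs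
begin

text \<open>
  Since \<open>\<phi> a = 0\<close>, one has \<open>\<phi> x = (x - a) \<Delta>(x, a)\<close>, so the secant step contracts the
  distance to \<open>a\<close> by the factor
  \<open>(S(x, y) - a) / (x - a) = 1 - \<Delta>(x, a) / \<Delta>(x, y)\<close> (lemma \<open>secant_step_ratio\<close>), and
  the theorem says precisely that \<open>\<Delta>(x, a) / \<Delta>(x, y)\<close> lies strictly between 0 and 1.

  The only analytic input is that difference quotients grow as one moves away from \<open>a\<close>
  (lemma \<open>diff_quot_ratio_outward\<close>). By the mean value theorem they are values of the derivative
  on disjoint intervals, the outer one having the larger absolute value by hypothesis. They have
  the same sign because the derivative is continuous and vanishes nowhere on the interval
  \<open>U - {a}\<close>.

  If \<open>y\<close> is farther from \<open>a\<close> than \<open>x\<close>, this applies directly to \<open>a, x, y\<close>. If \<open>y\<close> lies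
  between \<open>a\<close> and \<open>x\<close>, it bounds \<open>\<Delta>(y, a) / \<Delta>(x, y)\<close>, and \<open>\<Delta>(x, a)\<close> is a proper
  convex combination of \<open>\<Delta>(y, a)\<close> and \<open>\<Delta>(x, y)\<close>, so the ratio stays in the open unit
  interval.
\<close>

lemma diff_quot_commute: "diff_quot f x y = diff_quot f y x"
  unfolding diff_quot_def by (metis minus_diff_eq minus_divide_divide)

lemma secant_step_ratio:
  assumes "f a = 0" "x \<noteq> a"
  shows "(secant_step f x y - a) / (x - a) = 1 - diff_quot f x a / diff_quot f x y"
proof -
  have "f x = (x - a) * diff_quot f x a"
    using assms by (simp add: diff_quot_def)
  then have "secant_step f x y - a = (x - a) * (1 - diff_quot f x a / diff_quot f x y)"
    by (simp add: secant_step_def algebra_simps)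
  with assms(2) show ?thesis by simp
qed

lemma diff_quot_eq_deriv:
  fixes f :: "real \<Rightarrow> real"
  assumes diff: "\<And>x. f differentiable at x" and "p \<noteq> q"
  obtains \<xi> where "\<xi> \<in> open_segment p q" "diff_quot f q p = deriv f \<xi>"
proof -
  have der: "\<And>x. (f has_real_derivative deriv f x) (at x)"
    using diff DERIV_deriv_iff_real_differentiable by blast
  have *: "\<exists>z. u < z \<and> z < v \<and> diff_quot f v u = deriv f z" if uv: "u < v" for u v
  proof -
    obtain z where "u < z" "z < v" "f v - f u = (v - u) * deriv f z"
      using MVT2[OF uv, of f "deriv f"] der by blast
    with uv show ?thesis by (auto simp: diff_quot_def)
  qed
  show ?thesis
  proof (cases "p < q")
    case True
    with *[OF this] that show ?thesis
      by (auto simp: open_segment_eq_real_ivl)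
  next
    case False
    with \<open>p \<noteq> q\<close> have "q < p" by simp
    with *[OF this] that show ?thesis
      by (auto simp: open_segment_eq_real_ivl diff_quot_commute[of f q p])
  qed
qed

lemma connected_one_sided_nbhd_punctured:
  assumes "one_sided_nbhd a U"
  shows "connected (U - {a})"
proof -
  have "{a..<a + r} - {a} = {a<..<a + r}" "{a - r<..a} - {a} = {a - r<..<a}" for r
    by auto
  with assms show ?thesis by (auto simp: one_sided_nbhd_def)
qed

lemma one_sided_nbhd_between:
  assumes "one_sided_nbhd a U" "p \<in> U" "q \<in> U" "\<bar>p - a\<bar> < \<bar>q - a\<bar>" "z \<in> open_segment p q"
  shows "z \<in> U" "\<bar>p - a\<bar> < \<bar>z - a\<bar>" "\<bar>z - a\<bar> < \<bar>q - a\<bar>"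
proof -
  obtain r where r: "U = {a..<a + r} \<or> U = {a - r<..a}"
    using assms(1) by (auto simp: one_sided_nbhd_def)
  have z: "p < z \<and> z < q \<or> q < z \<and> z < p"
    using assms(5) by (auto simp: open_segment_eq_real_ivl split: if_splits)
  from r have "z \<in> U \<and> \<bar>p - a\<bar> < \<bar>z - a\<bar> \<and> \<bar>z - a\<bar> < \<bar>q - a\<bar>"
  proof
    assume U: "U = {a..<a + r}"
    then have "a \<le> p" "q < a + r" "p < z" "z < q" using assms(2-4) z by auto
    then show ?thesis by (simp add: U)
  next
    assume U: "U = {a - r<..a}"
    then have "p \<le> a" "a - r < q" "z < p" "q < z" using assms(2-4) z by auto
    then show ?thesis by (simp add: U)
  qed
  then show "z \<in> U" "\<bar>p - a\<bar> < \<bar>z - a\<bar>" "\<bar>z - a\<bar> < \<bar>q - a\<bar>" by simp_all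
qed

text \<open>
  A continuous function without zeros on a connected set cannot change sign; dividing two of its
  values expresses this without having to name the sign.
\<close>
lemma nonvanishing_connected_ratio_pos:
  fixes g :: "'a::topological_space \<Rightarrow> real"
  assumes "connected S" "continuous_on S g" "\<And>x. x \<in> S \<Longrightarrow> g x \<noteq> 0" "u \<in> S" "v \<in> S"
  shows "0 < g u / g v"
proof (rule ccontr)
  assume neg: "\<not> 0 < g u / g v"
  have "connected (g ` S)"
    using assms(1,2) by (rule connected_continuous_image[rotated])
  moreover have "g u \<in> g ` S" "g v \<in> g ` S" using assms(4,5) by auto
  moreover have "g u \<le> 0 \<and> 0 \<le> g v \<or> g v \<le> 0 \<and> 0 \<le> g u"
    using neg by (auto simp: zero_less_divide_iff not_less)
  ultimately have "0 \<in> g ` S"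
    by (meson connected_contains_Icc atLeastAtMost_iff subsetD)
  with assms(3) show False by auto
qed

text \<open>
  This is the mean value theorem on two adjacent intervals: the outer slope is a value of the
  derivative farther from \<open>a\<close>, hence larger in absolute value and of the same sign.
\<close>
lemma diff_quot_ratio_outward:
  fixes f :: "real \<Rightarrow> real"
  assumes smooth: "f C1_differentiable_on UNIV"
    and nbhd: "one_sided_nbhd a U"
    and incr: "\<And>x y. x \<in> U \<Longrightarrow> y \<in> U \<Longrightarrow> \<bar>x - a\<bar> < \<bar>y - a\<bar> \<Longrightarrow> \<bar>deriv f x\<bar> < \<bar>deriv f y\<bar>"
    and U: "p \<in> U" "q \<in> U" "s \<in> U"
    and less: "\<bar>p - a\<bar> < \<bar>q - a\<bar>" "\<bar>q - a\<bar> < \<bar>s - a\<bar>"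
  shows "diff_quot f q p / diff_quot f s q \<in> {0<..<1}"
proof -
  have diff: "\<And>x. f differentiable at x" and cont: "continuous_on UNIV (deriv f)"
    using smooth
    by (simp_all add: C1_differentiable_on_eq field_derivative_eq_vector_derivative)
  have "p \<noteq> q" "q \<noteq> s" using less by auto
  obtain \<xi> where \<xi>: "\<xi> \<in> open_segment p q" "diff_quot f q p = deriv f \<xi>"
    using diff_quot_eq_deriv[OF diff \<open>p \<noteq> q\<close>] .
  obtain \<eta> where \<eta>: "\<eta> \<in> open_segment q s" "diff_quot f s q = deriv f \<eta>"
    using diff_quot_eq_deriv[OF diff \<open>q \<noteq> s\<close>] .
  note \<xi>' = one_sided_nbhd_between[OF nbhd U(1,2) less(1) \<xi>(1)]
  note \<eta>' = one_sided_nbhd_between[OF nbhd U(2,3) less(2) \<eta>(1)]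
  have abs: "\<bar>deriv f \<xi>\<bar> < \<bar>deriv f \<eta>\<bar>"
    using incr[OF \<xi>'(1) \<eta>'(1)] \<xi>'(3) \<eta>'(2) by linarith
  have "a \<in> U" using nbhd by (auto simp: one_sided_nbhd_def)
  \<comment> \<open>Comparison with \<open>a\<close> itself: a strict upper bound of an absolute value is nonzero.\<close>
  have nz: "deriv f z \<noteq> 0" if "z \<in> U - {a}" for z
    using incr[OF \<open>a \<in> U\<close>, of z] that by auto
  have "0 < deriv f \<xi> / deriv f \<eta>"
  proof (rule nonvanishing_connected_ratio_pos[where g = "deriv f",
        OF connected_one_sided_nbhd_punctured[OF nbhd]])
    show "continuous_on (U - {a}) (deriv f)" using cont continuous_on_subset by blast
  qed (use nz \<xi>' \<eta>' in auto)
  moreover have "deriv f \<xi> / deriv f \<eta> < 1"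
    using abs by (auto simp: divide_less_eq)
  ultimately show ?thesis by (simp add: \<xi>(2) \<eta>(2))
qed

theorem lemma2p1:
  fixes \<phi> :: "real \<Rightarrow> real" and a :: real and U :: "real set"
  assumes smooth: "\<phi> C1_differentiable_on UNIV"
    and root: "\<phi> a = 0"
    and nbhd: "one_sided_nbhd a U"
    and incr: "\<And>x y. x \<in> U \<Longrightarrow> y \<in> U \<Longrightarrow> \<bar>x - a\<bar> < \<bar>y - a\<bar> \<Longrightarrow> \<bar>deriv \<phi> x\<bar> < \<bar>deriv \<phi> y\<bar>"
  shows "\<forall>x\<in>U. \<forall>y\<in>U. x \<noteq> a \<longrightarrow> y \<noteq> a \<longrightarrow> x \<noteq> y \<longrightarrow>
           0 < (secant_step \<phi> x y - a) / (x - a) \<and> (secant_step \<phi> x y - a) / (x - a) < 1"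
proof (intro ballI impI)
  fix x y assume xy: "x \<in> U" "y \<in> U" "x \<noteq> a" "y \<noteq> a" "x \<noteq> y"
  have "a \<in> U" using nbhd by (auto simp: one_sided_nbhd_def)
  note outward = diff_quot_ratio_outward[OF smooth nbhd incr]
  have "\<bar>x - a\<bar> \<noteq> \<bar>y - a\<bar>"
    using nbhd xy by (auto simp: one_sided_nbhd_def)
  then consider "\<bar>x - a\<bar> < \<bar>y - a\<bar>" | "\<bar>y - a\<bar> < \<bar>x - a\<bar>" by linarith
  then have "diff_quot \<phi> x a / diff_quot \<phi> x y \<in> {0<..<1}"
  proof cases
    case 1
    with outward[of a x y] xy \<open>a \<in> U\<close> show ?thesis
      by (simp add: diff_quot_commute[of \<phi> x y])
  next
    case 2
    define \<rho> where "\<rho> = diff_quot \<phi> y a / diff_quot \<phi> x y"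
    define w where "w = (y - a) / (x - a)"
    have \<rho>: "0 < \<rho>" "\<rho> < 1"
      using outward[of a y x] 2 xy \<open>a \<in> U\<close> by (simp_all add: \<rho>_def)
    have w: "0 < w" "w < 1"
      using nbhd xy 2 by (auto simp: w_def one_sided_nbhd_def divide_simps)
    have "diff_quot \<phi> x y \<noteq> 0" using \<rho>(1) by (auto simp: \<rho>_def)
    \<comment> \<open>The slope from \<open>a\<close> to \<open>x\<close> averages the slopes over its two parts, weighted by length.\<close>
    have "diff_quot \<phi> x a = w * diff_quot \<phi> y a + (1 - w) * diff_quot \<phi> x y"
    proof -
      have "1 - w = (x - y) / (x - a)"
        using xy by (simp add: w_def field_simps)
      then show ?thesis
        using xy by (simp add: w_def diff_quot_def add_divide_distrib[symmetric])
    qed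
    with \<open>diff_quot \<phi> x y \<noteq> 0\<close> have eq: "diff_quot \<phi> x a / diff_quot \<phi> x y = w * \<rho> + (1 - w)"
      by (simp add: \<rho>_def add_divide_distrib)
    have "0 < w * \<rho>" "w * \<rho> < w" using w \<rho> by simp_all
    with w show ?thesis unfolding eq by simp
  qed
  then show "0 < (secant_step \<phi> x y - a) / (x - a) \<and> (secant_step \<phi> x y - a) / (x - a) < 1"
    by (simp add: secant_step_ratio[of \<phi>, OF root \<open>x \<noteq> a\<close>])
qed

end
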